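(* Let $(X,\|\cdot\|)$ be a normed space, let $C\subseteq X$ be a convex set with $\operatorname{diam}(C)=1$, and let $T:C\to C$ be any nonexpansive map, i.e. $\|Tx-Ty\|\le\|x-y\|$ for all $x,y\in C$. Let $(\alpha_n)_{n\ge1}$ be a sequence in $]0,1[$, let $x^0\in C$, and let $x^{n+1}=(1-\alpha_{n+1})x^n+\alpha_{n+1}Tx^n$ for $n\ge0$ be the corresponding Krasnosel'skii–Mann iterates. Let $d_{mn}$ be the recursive optimal transport bounds associated with $(\alpha_n)_{n\ge1}$ (defined in the context). Then $\|x^m-x^n\|\le d_{mn}$ for all $m,n\in\mathbb N$.
   Context: $\mathbb N=\{0,1,2,\dots\}$ and $\mathcal N=\{-1,0,1,2,\dots\}$. Given $(\alpha_n)_{n\ge1}\subseteq\,]0,1[$, set $\alpha_0=1$ and, for $n\in\mathbb N$ and $i=0,\dots,n$, $\pi_i^n=\alpha_i\prod_{k=i+1}^n(1-\alpha_k)$; for each $n$, $(\pi_i^n)_{i=0}^n$ is a probability distribution on $\{0,\dots,n\}$. The numbers $d_{mn}$, $m,n\in\mathcal N$, are defined recursively by $d_{-1,-1}=0$, $d_{-1,k}=d_{k,-1}=1$ for all $k\in\mathbb N$, and for $m,n\in\mathbb N$ $$d_{mn}=\min_{z\in F^{mn}}\ \sum_{i=0}^m\sum_{j=0}^n z_{ij}\,d_{i-1,j-1},$$ where $F^{mn}$ is the set of transport plans from $\pi^m$ to $\pi^n$, i.e. of all real arrays $z=(z_{ij})_{0\le i\le m,\,0\le j\le n}$ with $z_{ij}\ge0$,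 $\sum_{j=0}^n z_{ij}=\pi_i^m$ for all $i=0,\dots,m$, and $\sum_{i=0}^m z_{ij}=\pi_j^n$ for all $j=0,\dots,n$. *)

theory Defs
  imports "HOL-Analysis.Analysis"
begin

text \<open>
  The step sizes are a sequence \<open>\<alpha> :: nat \<Rightarrow> real\<close> of which only the terms with index \<open>\<ge> 1\<close>
  matter; the convention \<open>\<alpha>\<^sub>0 = 1\<close> is built into \<open>km_weight\<close>, so \<open>\<alpha> 0\<close> is never used.
\<close>

definition km_weight :: "(nat \<Rightarrow> real) \<Rightarrow> nat \<Rightarrow> nat \<Rightarrow> real" where
  "km_weight \<alpha> n i = (if i = 0 then 1 else \<alpha> i) * (\<Prod>k=i+1..n. 1 - \<alpha> k)"

text \<open>
  Transport plans from \<open>\<pi>\<^sup>m\<close> to \<open>\<pi>\<^sup>n\<close>. An array is a function on \<open>nat \<times> nat\<close> whose entries outside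
  \<open>{0..m} \<times> {0..n}\<close> are arbitrary; they do not enter the transport cost.
\<close>

definition transport_plans :: "(nat \<Rightarrow> real) \<Rightarrow> nat \<Rightarrow> nat \<Rightarrow> (nat \<Rightarrow> nat \<Rightarrow> real) set" where
  "transport_plans \<alpha> m n = {z.
     (\<forall>i\<le>m. \<forall>j\<le>n. 0 \<le> z i j) \<and>
     (\<forall>i\<le>m. (\<Sum>j=0..n. z i j) = km_weight \<alpha> m i) \<and>
     (\<forall>j\<le>n. (\<Sum>i=0..m. z i j) = km_weight \<alpha> n j)}"

text \<open>
  The bounds \<open>d\<^sub>m\<^sub>n\<close> for \<open>m, n \<in> {-1, 0, 1, \<dots>}\<close>. The minimum over plans is the least element of the set
  of transport costs; \<open>ot_bound_is_min\<close> below shows that it is attained. Indices below \<open>-1\<close>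
  are outside the domain of the recursion.
\<close>

function ot_bound :: "(nat \<Rightarrow> real) \<Rightarrow> int \<Rightarrow> int \<Rightarrow> real" where
  "ot_bound \<alpha> m n =
     (if m < -1 \<or> n < -1 then undefined
      else if m = -1 \<and> n = -1 then 0
      else if m = -1 \<or> n = -1 then 1
      else (LEAST c. c \<in> (\<lambda>z. \<Sum>i=0..nat m. \<Sum>j=0..nat n.
                               z i j * ot_bound \<alpha> (int i - 1) (int j - 1))
                          ` transport_plans \<alpha> (nat m) (nat n)))"
  by pat_completeness auto
termination
  by (relation "Wellfounded.measure (\<lambda>(\<alpha>, m, n). nat (m + 1) + nat (n + 1))") auto

declare ot_bound.simps [simp del]

definition transport_cost :: "(nat \<Rightarrow> real) \<Rightarrow> nat \<Rightarrow> nat \<Rightarrow> (nat \<Rightarrow> nat \<Rightarrow> real) \<Rightarrow> real" where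
  "transport_cost \<alpha> m n z =
     (\<Sum>i=0..m. \<Sum>j=0..n. z i j * ot_bound \<alpha> (int i - 1) (int j - 1))"

lemma ot_bound_minus_one:
  "ot_bound \<alpha> (-1) (-1) = 0"
  "ot_bound \<alpha> (-1) (int k) = 1"
  "ot_bound \<alpha> (int k) (-1) = 1"
  by (simp_all add: ot_bound.simps)

lemma ot_bound_nat:
  "ot_bound \<alpha> (int m) (int n) = (LEAST c. c \<in> transport_cost \<alpha> m n ` transport_plans \<alpha> m n)"
  unfolding transport_cost_def [abs_def] by (subst ot_bound.simps) simp

lemma km_weight_nonneg:
  assumes "\<And>k. k \<ge> 1 \<Longrightarrow> 0 < \<alpha> k \<and> \<alpha> k < 1"
  shows "0 \<le> km_weight \<alpha> n i"
proof -
  have "0 \<le> (\<Prod>k=i+1..n. 1 - \<alpha> k)"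
    by (rule prod_nonneg) (use assms in \<open>auto simp: less_imp_le\<close>)
  moreover have "0 \<le> (if i = 0 then 1 else \<alpha> i)"
    using assms [of i] by auto
  ultimately show ?thesis
    unfolding km_weight_def by simp
qed

lemma km_weight_sum: "(\<Sum>i=0..n. km_weight \<alpha> n i) = 1"
proof (induction n)
  case 0
  show ?case by (simp add: km_weight_def)
next
  case (Suc n)
  have "km_weight \<alpha> (Suc n) i = (1 - \<alpha> (Suc n)) * km_weight \<alpha> n i" if "i \<le> n" for i
    using that by (simp add: km_weight_def)
  then have "(\<Sum>i=0..n. km_weight \<alpha> (Suc n) i) = (1 - \<alpha> (Suc n)) * (\<Sum>i=0..n. km_weight \<alpha> n i)"
    by (simp add: sum_distrib_left)
  then show ?case
    using Suc by (simp add: km_weight_def)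
qed

lemma transport_cost_attains_min:
  assumes \<alpha>: "\<And>k. k \<ge> 1 \<Longrightarrow> 0 < \<alpha> k \<and> \<alpha> k < 1"
  shows "\<exists>z\<in>transport_plans \<alpha> m n. \<forall>w\<in>transport_plans \<alpha> m n.
           transport_cost \<alpha> m n z \<le> transport_cost \<alpha> m n w"
proof -
  define F where "F = (\<lambda>z :: nat \<times> nat \<Rightarrow> real. transport_cost \<alpha> m n (curry z))"
  define P where "P = {z :: nat \<times> nat \<Rightarrow> real. curry z \<in> transport_plans \<alpha> m n}"
  define B where "B = (UNIV :: (nat \<times> nat) set) \<rightarrow>\<^sub>E {0..1::real}"
  have cont: "continuous_on UNIV (\<lambda>z :: nat \<times> nat \<Rightarrow> real. z p)" for p
    by (rule continuous_on_product_coordinates)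
  have "compact B"
    unfolding B_def
    using compactin_PiE [of "\<lambda>_ :: nat \<times> nat. euclideanreal" UNIV "\<lambda>_. {0..1}"]
    by (simp add: euclidean_product_topology)
  moreover have "closed P"
    unfolding P_def transport_plans_def mem_Collect_eq curry_def
    by (intro closed_Collect_conj closed_Collect_all closed_Collect_imp closed_Collect_le
        closed_Collect_eq continuous_intros cont open_Collect_const)
  ultimately have cpt: "compact (B \<inter> P)"
    by (rule compact_Int_closed)
  have clip: "\<exists>z. z \<in> B \<inter> P \<and> F z = transport_cost \<alpha> m n w"
    if w: "w \<in> transport_plans \<alpha> m n" for w
  proof -
    define z where "z = (\<lambda>(i, j). if i \<le> m \<and> j \<le> n then w i j else 0)"
    have le1: "w i j \<le> 1" if "i \<le> m" "j \<le> n" for i j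
    proof -
      have "w i j \<le> (\<Sum>j=0..n. w i j)"
        using w that by (intro member_le_sum) (auto simp: transport_plans_def)
      also have "\<dots> = km_weight \<alpha> m i"
        using w that by (auto simp: transport_plans_def)
      also have "\<dots> \<le> (\<Sum>i=0..m. km_weight \<alpha> m i)"
        using that km_weight_nonneg [of \<alpha>, OF \<alpha>] by (intro member_le_sum) auto
      finally show ?thesis by (simp add: km_weight_sum)
    qed
    have "z \<in> B"
      using w le1 by (auto simp: B_def z_def transport_plans_def PiE_def)
    moreover have "z \<in> P"
      using w by (auto simp: P_def z_def transport_plans_def curry_def)
    moreover have "F z = transport_cost \<alpha> m n w"
      by (simp add: F_def z_def transport_cost_def curry_def)
    ultimately show ?thesis by blast
  qed
  have "(\<lambda>i j. km_weight \<alpha> m i * km_weight \<alpha> n j) \<in> transport_plans \<alpha> m n"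
    using km_weight_nonneg [of \<alpha>, OF \<alpha>]
    by (auto simp: transport_plans_def km_weight_sum simp flip: sum_distrib_left sum_distrib_right)
  from clip [OF this] have ne: "B \<inter> P \<noteq> {}" by blast
  have "continuous_on UNIV F"
    unfolding F_def transport_cost_def curry_def
    by (intro continuous_intros cont)
  then have "continuous_on (B \<inter> P) F"
    by (rule continuous_on_subset) simp
  from continuous_attains_inf [OF cpt ne this]
  obtain z where z: "z \<in> B \<inter> P" "\<forall>y\<in>B \<inter> P. F z \<le> F y" by blast
  show ?thesis
  proof (intro bexI ballI)
    show "curry z \<in> transport_plans \<alpha> m n"
      using z by (simp add: P_def)
    fix w assume "w \<in> transport_plans \<alpha> m n"
    from clip [OF this] z show "transport_cost \<alpha> m n (curry z) \<le> transport_cost \<alpha> m n w"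
      unfolding F_def by metis
  qed
qed

lemma ot_bound_is_min:
  assumes "\<And>k. k \<ge> 1 \<Longrightarrow> 0 < \<alpha> k \<and> \<alpha> k < 1"
  shows "\<exists>z\<in>transport_plans \<alpha> m n. ot_bound \<alpha> (int m) (int n) = transport_cost \<alpha> m n z"
    and "w \<in> transport_plans \<alpha> m n \<Longrightarrow> ot_bound \<alpha> (int m) (int n) \<le> transport_cost \<alpha> m n w"
proof -
  obtain z where z: "z \<in> transport_plans \<alpha> m n"
    "\<And>w. w \<in> transport_plans \<alpha> m n \<Longrightarrow> transport_cost \<alpha> m n z \<le> transport_cost \<alpha> m n w"
    using transport_cost_attains_min [of \<alpha> m n, OF assms] by blast
  have eq: "ot_bound \<alpha> (int m) (int n) = transport_cost \<alpha> m n z"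
    unfolding ot_bound_nat by (rule Least_equality) (use z in auto)
  show "\<exists>z\<in>transport_plans \<alpha> m n. ot_bound \<alpha> (int m) (int n) = transport_cost \<alpha> m n z"
    using z eq by blast
  show "ot_bound \<alpha> (int m) (int n) \<le> transport_cost \<alpha> m n w" if "w \<in> transport_plans \<alpha> m n"
    using z(2) [OF that] eq by simp
qed

end

theory Submission
  imports Defs
begin

text \<open>
  With \<open>y\<^sub>0 = x\<^sup>0\<close> and \<open>y\<^sub>i = T x\<^sup>i\<^sup>-\<^sup>1\<close>, the iterate \<open>x\<^sup>n\<close> is the average of the \<open>y\<^sub>i\<close> with weights
  \<open>\<pi>\<^sub>i\<^sup>n\<close>. A plan \<open>z\<close> from \<open>\<pi>\<^sup>m\<close> to \<open>\<pi>\<^sup>n\<close> therefore gives \<open>x\<^sup>m - x\<^sup>n = \<Sum> z\<^sub>i\<^sub>j (y\<^sub>i - y\<^sub>j)\<close>, and by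
  nonexpansiveness, the diameter bound and induction each norm \<open>\<parallel>y\<^sub>i - y\<^sub>j\<parallel>\<close> is at most
  the transport cost from \<open>i\<close> to \<open>j\<close>.
\<close>

lemma km_weight_Suc:
  "i \<le> n \<Longrightarrow> km_weight \<alpha> (Suc n) i = (1 - \<alpha> (Suc n)) * km_weight \<alpha> n i"
  "km_weight \<alpha> (Suc n) (Suc n) = \<alpha> (Suc n)"
  by (simp_all add: km_weight_def)

text \<open>Each step scales the old weights by \<open>1 - \<alpha> (Suc n)\<close> and gives the
  new point \<open>y (Suc n)\<close> the weight \<open>\<alpha> (Suc n)\<close>.\<close>

lemma km_iterate_eq_average:
  fixes x y :: "nat \<Rightarrow> 'a::real_vector"
  assumes "x 0 = y 0"
    and step: "\<And>k. x (Suc k) = (1 - \<alpha> (Suc k)) *\<^sub>R x k + \<alpha> (Suc k) *\<^sub>R y (Suc k)"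
  shows "x n = (\<Sum>i=0..n. km_weight \<alpha> n i *\<^sub>R y i)"
proof (induction n)
  case 0
  show ?case using assms(1) by (simp add: km_weight_def)
next
  case (Suc n)
  have "(\<Sum>i=0..n. km_weight \<alpha> (Suc n) i *\<^sub>R y i) = (1 - \<alpha> (Suc n)) *\<^sub>R x n"
    by (simp add: Suc scaleR_sum_right km_weight_Suc)
  then show ?case
    by (simp add: step km_weight_Suc)
qed

text \<open>The row sums of \<open>z\<close> split the weights of the first average, its column sums
  those of the second, so both become double sums over the same \<open>z i j\<close>.\<close>

lemma transport_plan_average_diff:
  fixes y :: "nat \<Rightarrow> 'a::real_vector"
  assumes z: "z \<in> transport_plans \<alpha> m n"
  shows "(\<Sum>i=0..m. km_weight \<alpha> m i *\<^sub>R y i) - (\<Sum>j=0..n. km_weight \<alpha> n j *\<^sub>R y j)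
         = (\<Sum>i=0..m. \<Sum>j=0..n. z i j *\<^sub>R (y i - y j))"
proof -
  have "(\<Sum>i=0..m. km_weight \<alpha> m i *\<^sub>R y i) = (\<Sum>i=0..m. \<Sum>j=0..n. z i j *\<^sub>R y i)"
    using z by (simp add: transport_plans_def flip: scaleR_sum_left)
  moreover have "(\<Sum>j=0..n. km_weight \<alpha> n j *\<^sub>R y j) = (\<Sum>j=0..n. \<Sum>i=0..m. z i j *\<^sub>R y j)"
    using z by (simp add: transport_plans_def flip: scaleR_sum_left)
  moreover have "\<dots> = (\<Sum>i=0..m. \<Sum>j=0..n. z i j *\<^sub>R y j)"
    by (rule sum.swap)
  ultimately show ?thesis
    by (simp add: scaleR_diff_right sum_subtractf)
qed

lemma norm_average_diff_le_transport_cost: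
  fixes y :: "nat \<Rightarrow> 'a::real_normed_vector"
  assumes z: "z \<in> transport_plans \<alpha> m n"
    and le: "\<And>i j. i \<le> m \<Longrightarrow> j \<le> n \<Longrightarrow> norm (y i - y j) \<le> ot_bound \<alpha> (int i - 1) (int j - 1)"
  shows "norm ((\<Sum>i=0..m. km_weight \<alpha> m i *\<^sub>R y i) - (\<Sum>j=0..n. km_weight \<alpha> n j *\<^sub>R y j))
         \<le> transport_cost \<alpha> m n z"
  unfolding transport_plan_average_diff [OF z] transport_cost_def
proof (intro sum_norm_le)
  fix i j assume "i \<in> {0..m}" "j \<in> {0..n}"
  then show "norm (z i j *\<^sub>R (y i - y j)) \<le> z i j * ot_bound \<alpha> (int i - 1) (int j - 1)"
    using z le by (simp add: transport_plans_def mult_left_mono)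
qed

theorem theorem2p1:
  fixes C :: "'a::real_normed_vector set"
    and T :: "'a \<Rightarrow> 'a"
    and \<alpha> :: "nat \<Rightarrow> real"
    and x :: "nat \<Rightarrow> 'a"
    and m n :: nat
  assumes "convex C"
    and "bounded C" and "diameter C = 1"
    and "T ` C \<subseteq> C"
    and "\<And>u v. u \<in> C \<Longrightarrow> v \<in> C \<Longrightarrow> norm (T u - T v) \<le> norm (u - v)"
    and "\<And>k. k \<ge> 1 \<Longrightarrow> 0 < \<alpha> k \<and> \<alpha> k < 1"
    and "x 0 \<in> C"
    and "\<And>k. x (k + 1) = (1 - \<alpha> (k + 1)) *\<^sub>R x k + \<alpha> (k + 1) *\<^sub>R T (x k)"
  shows "norm (x m - x n) \<le> ot_bound \<alpha> (int m) (int n)"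
proof -
  \<comment> \<open>The shift matches the cost index \<open>i - 1\<close>; the start point
    \<open>x 0\<close> takes the place of index -1.\<close>
  define y where "y = (\<lambda>i. if i = 0 then x 0 else T (x (i - 1)))"
  have xC: "x k \<in> C" for k
  proof (induction k)
    case (Suc k)
    with assms(4) have "T (x k) \<in> C" by blast
    with Suc assms(6) [of "k + 1"] show ?case
      using assms(8) [of k] convexD [OF assms(1), of "x k" "T (x k)" "1 - \<alpha> (k + 1)" "\<alpha> (k + 1)"]
      by simp
  qed (rule assms(7))
  then have yC: "y k \<in> C" for k
    using assms(4) by (auto simp: y_def)
  have average: "x k = (\<Sum>i=0..k. km_weight \<alpha> k i *\<^sub>R y i)" for k
    by (rule km_iterate_eq_average) (use assms(8) in \<open>simp_all add: y_def\<close>)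
  show ?thesis
  proof (induction "m + n" arbitrary: m n rule: less_induct)
    case less
    have le: "norm (y i - y j) \<le> ot_bound \<alpha> (int i - 1) (int j - 1)" if "i \<le> m" "j \<le> n" for i j
    proof -
      \<comment> \<open>This settles the case where exactly one index is 0, with cost 1. For
        \<open>i = j = 0\<close> the cost is 0 and the difference vanishes.\<close>
      have le1: "norm (y i - y j) \<le> 1"
        using diameter_bounded_bound [OF assms(2) yC yC, of i j] assms(3) by (simp add: dist_norm)
      show ?thesis
      proof (cases i; cases j)
        fix i' j' assume ij: "i = Suc i'" "j = Suc j'"
        have "norm (y i - y j) \<le> norm (x i' - x j')"
          using assms(5) [OF xC xC] by (simp add: y_def ij)
        \<comment> \<open>The induction hypothesis applies since
          \<open>i' + j' < i + j \<le> m + n\<close>.\<close>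
        also have "\<dots> \<le> ot_bound \<alpha> (int i') (int j')"
          by (rule less) (use that ij in simp)
        finally show ?thesis by (simp add: ij)
      qed (use le1 in \<open>simp_all add: ot_bound_minus_one\<close>)
    qed
    obtain z where z: "z \<in> transport_plans \<alpha> m n"
      and min: "ot_bound \<alpha> (int m) (int n) = transport_cost \<alpha> m n z"
      using ot_bound_is_min(1) [of \<alpha> m n, OF assms(6)] by blast
    show ?case
      unfolding average [of m] average [of n] min
      by (rule norm_average_diff_le_transport_cost [OF z le])
  qed
qed

end
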